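(* The left absorbing probabilities $P_{\underline{-1,0,N}}(0,0,1)$ of the Grover walk started in $|0,R\rangle$ with absorbing boundaries at $-1$ and $N$, with the convention $P_{\underline{-1,0,0}}(0,0,1)=0$, obey the recurrence $$P_{\underline{-1,0,N+1}}(0,0,1)=\frac{2+3P_{\underline{-1,0,N}}(0,0,1)}{3+4P_{\underline{-1,0,N}}(0,0,1)}\qquad\text{for all integers } N\ge 0.$$
   Context: The Grover walk acts on the Hilbert space $\mathcal H=\ell^2(\mathbb Z)\otimes\mathbb C^3$ with orthonormal basis $|m,c\rangle=|m\rangle\otimes|c\rangle$, $m\in\mathbb Z$, $c\in\{L,S,R\}$. The evolution operator is $U=\mathrm{Sh}\cdot(I\otimes G)$, where, in the ordered basis $(L,S,R)$, $G=\frac13\begin{pmatrix}-1&2&2\\2&-1&2\\2&2&-1\end{pmatrix}$, and the shift is $\mathrm{Sh}|m,L\rangle=|m-1,L\rangle$, $\mathrm{Sh}|m,S\rangle=|m,S\rangle$, $\mathrm{Sh}|m,R\rangle=|m+1,R\rangle$. For $n\in\mathbb Z$, $\Pi_{yes}^{n}=|n\rangle\langle n|\otimes I$ and $\Pi_{no}^{n}=I-\Pi_{yes}^{n}$. Two-boundary process with boundaries $-M<0<N$: start in $\psi_0=\alpha|0,L\rangle+\beta|0,S\rangle+\gamma|0,R\rangle$ (unit vector); at each step apply $U$, measure $\{\Pi_{yes}^{-M},\Pi_{no}^{-M}\}$, then measure $\{\Pi_{yes}^{N},\Pi_{no}^{N}\}$, stopping when either outcome is "yes". The left absorbing probability is,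 for $M,N\ge1$, $$P_{\underline{-M,0,N}}(\alpha,\beta,\gamma)=\sum_{t\ge1}\big\|\Pi_{yes}^{-M}U(\Pi_{no}^{N}\Pi_{no}^{-M}U)^{t-1}\psi_0\big\|^2 .$$ For $N=0$ the value $P_{\underline{-1,0,0}}(0,0,1)$ is defined to be $0$ by convention (it is the initial condition of the recurrence). *)

theory Defs
  imports "HOL-Analysis.Analysis"
begin

datatype coin = L | S | R

lemma UNIV_coin: "UNIV = {L, S, R}"
  by (auto intro: coin.exhaust)

instance coin :: finite
  by standard (simp add: UNIV_coin)

text \<open>The space $\ell^2(\mathbb{Z}) \otimes \mathbb{C}^3$ is realised as the square-summable
  functions from the integers to \<^typ>\<open>complex^coin\<close>. The operators below are given by
  their coordinate formulas on arbitrary functions; the lemmas that follow show that they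
  preserve square-summability and act on basis vectors as they should.\<close>

type_synonym state = "int \<Rightarrow> complex^coin"

definition walk_space :: "state set" where
  "walk_space = {\<psi>. (\<lambda>m. (norm (\<psi> m))\<^sup>2) summable_on UNIV}"

definition walk_norm :: "state \<Rightarrow> real" where
  "walk_norm \<psi> = sqrt (\<Sum>\<^sub>\<infinity>m. (norm (\<psi> m))\<^sup>2)"

definition ket :: "int \<Rightarrow> coin \<Rightarrow> state" where
  "ket m c = (\<lambda>n. if n = m then axis c 1 else 0)"

definition grover :: "complex^coin^coin" where
  "grover = (\<chi> i j. (if i = j then -1 else 2) / 3)"

definition coin_flip :: "state \<Rightarrow> state" where
  "coin_flip \<psi> = (\<lambda>m. grover *v \<psi> m)"

definition shift :: "state \<Rightarrow> state" where
  "shift \<psi> = (\<lambda>m. \<chi> c. case c of L \<Rightarrow> \<psi> (m + 1) $ L | S \<Rightarrow> \<psi> m $ S | R \<Rightarrow> \<psi> (m - 1) $ R)"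

definition evolution :: "state \<Rightarrow> state" where
  "evolution = shift \<circ> coin_flip"

definition proj_yes :: "int \<Rightarrow> state \<Rightarrow> state" where
  "proj_yes n \<psi> = (\<lambda>m. if m = n then \<psi> m else 0)"

definition proj_no :: "int \<Rightarrow> state \<Rightarrow> state" where
  "proj_no n \<psi> = (\<lambda>m. \<psi> m - proj_yes n \<psi> m)"

definition initial_state :: "complex \<Rightarrow> complex \<Rightarrow> complex \<Rightarrow> state" where
  "initial_state \<alpha> \<beta> \<gamma> = (\<lambda>m. \<alpha> *s ket 0 L m + \<beta> *s ket 0 S m + \<gamma> *s ket 0 R m)"

definition no_step :: "nat \<Rightarrow> nat \<Rightarrow> state \<Rightarrow> state" where
  "no_step M N = proj_no (int N) \<circ> proj_no (- int M) \<circ> evolution"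

text \<open>Meaningful for $M, N \geq 1$.\<close>

definition left_absorption :: "nat \<Rightarrow> nat \<Rightarrow> complex \<Rightarrow> complex \<Rightarrow> complex \<Rightarrow> real" where
  "left_absorption M N \<alpha> \<beta> \<gamma> =
     (\<Sum>\<^sub>\<infinity>t\<in>{1..}. (walk_norm (proj_yes (- int M)
        (evolution ((no_step M N ^^ (t - 1)) (initial_state \<alpha> \<beta> \<gamma>)))))\<^sup>2)"

text \<open>The left absorbing probability from $|0,R\rangle$ with boundaries $-1$ and $N$; its value
  at $N = 0$ is a convention, as the walk then starts on a boundary.\<close>

definition P_left :: "nat \<Rightarrow> real" where
  "P_left N = (if N = 0 then 0 else left_absorption 1 N 0 0 1)"

lemma sum_coin: "(\<Sum>c\<in>UNIV. f c) = f L + f S + f R" for f :: "coin \<Rightarrow> 'a::comm_monoid_add"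
  by (simp add: UNIV_coin add.assoc)

lemma norm_coin: "(norm x)\<^sup>2 = (cmod (x$L))\<^sup>2 + (cmod (x$S))\<^sup>2 + (cmod (x$R))\<^sup>2"
  for x :: "complex^coin"
  by (simp add: norm_vec_def L2_set_def sum_coin)

lemma vec_eq_coin: "x = y \<longleftrightarrow> x$L = y$L \<and> x$S = y$S \<and> x$R = y$R"
  for x y :: "complex^coin"
  unfolding vec_eq_iff by (metis coin.exhaust)

lemma shift_ket:
  "shift (ket m L) = ket (m - 1) L"
  "shift (ket m S) = ket m S"
  "shift (ket m R) = ket (m + 1) R"
  by (auto simp: fun_eq_iff shift_def ket_def vec_eq_coin axis_def)

lemma coin_flip_ket:
  "coin_flip (ket m c) = (\<lambda>n. \<Sum>d\<in>UNIV. (grover $ d $ c) *s ket m d n)"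
  by (cases c) (auto simp: fun_eq_iff coin_flip_def ket_def vec_eq_coin sum_coin axis_def
      matrix_vector_mult_def)

lemma norm_grover: "(norm (grover *v x))\<^sup>2 = (norm x)\<^sup>2"
  unfolding norm_coin cmod_power2
  by (simp add: grover_def matrix_vector_mult_def sum_coin)
     (simp add: field_simps power2_eq_square)

lemma coin_flip_isometry:
  shows "coin_flip \<psi> \<in> walk_space \<longleftrightarrow> \<psi> \<in> walk_space"
    and "walk_norm (coin_flip \<psi>) = walk_norm \<psi>"
  by (simp_all add: walk_space_def walk_norm_def coin_flip_def norm_grover)

lemma walk_space_components:
  assumes "\<psi> \<in> walk_space"
  shows "(\<lambda>m. (cmod (\<psi> m $ c))\<^sup>2) summable_on UNIV"
proof (rule summable_on_comparison_test)
  show "(\<lambda>m. (norm (\<psi> m))\<^sup>2) summable_on UNIV"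
    using assms by (simp add: walk_space_def)
  show "(cmod (\<psi> m $ c))\<^sup>2 \<le> (norm (\<psi> m))\<^sup>2" for m
    by (cases c) (simp_all add: norm_coin)
qed auto

lemma shift_isometry:
  assumes "\<psi> \<in> walk_space"
  shows "shift \<psi> \<in> walk_space" and "walk_norm (shift \<psi>) = walk_norm \<psi>"
proof -
  define f where "f c m = (cmod (\<psi> m $ c))\<^sup>2" for c m
  have sf: "f c summable_on UNIV" for c
    unfolding f_def by (rule walk_space_components[OF assms])
  have bij: "bij_betw (\<lambda>m. m + k) UNIV UNIV" for k :: int
    by (rule bij_betw_byWitness[where f' = "\<lambda>m. m - k"]) auto
  have s: "(\<lambda>m. f c (m + k)) summable_on UNIV" for c k
    using sf[of c] summable_on_reindex_bij_betw[OF bij[of k], of "f c"] by simp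
  have i: "(\<Sum>\<^sub>\<infinity>m. f c (m + k)) = (\<Sum>\<^sub>\<infinity>m. f c m)" for c k
    using infsum_reindex_bij_betw[OF bij[of k], of "f c"] by simp
  have e: "(norm (shift \<psi> m))\<^sup>2 = f L (m + 1) + f S m + f R (m + (-1))" for m
    by (simp add: norm_coin shift_def f_def)
  have e': "(norm (\<psi> m))\<^sup>2 = f L m + f S m + f R m" for m
    by (simp add: norm_coin f_def)
  show "shift \<psi> \<in> walk_space"
    unfolding walk_space_def mem_Collect_eq e by (intro summable_on_add s sf)
  have "(\<Sum>\<^sub>\<infinity>m. (norm (shift \<psi> m))\<^sup>2) = (\<Sum>\<^sub>\<infinity>m. (norm (\<psi> m))\<^sup>2)"
    unfolding e e' by (simp only: infsum_add summable_on_add s sf i)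
  then show "walk_norm (shift \<psi>) = walk_norm \<psi>"
    by (simp add: walk_norm_def)
qed

lemma evolution_isometry:
  assumes "\<psi> \<in> walk_space"
  shows "evolution \<psi> \<in> walk_space" and "walk_norm (evolution \<psi>) = walk_norm \<psi>"
  using assms by (simp_all add: evolution_def shift_isometry coin_flip_isometry)

lemma proj_pythagoras:
  assumes "\<psi> \<in> walk_space"
  shows "proj_yes n \<psi> \<in> walk_space" and "proj_no n \<psi> \<in> walk_space"
    and "(walk_norm \<psi>)\<^sup>2 = (walk_norm (proj_yes n \<psi>))\<^sup>2 + (walk_norm (proj_no n \<psi>))\<^sup>2"
proof -
  have s: "(\<lambda>m. (norm (\<psi> m))\<^sup>2) summable_on UNIV"
    using assms by (simp add: walk_space_def)
  have y: "(\<lambda>m. (norm (proj_yes n \<psi> m))\<^sup>2) summable_on UNIV"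
    by (rule summable_on_comparison_test[OF s]) (auto simp: proj_yes_def)
  have o: "(\<lambda>m. (norm (proj_no n \<psi> m))\<^sup>2) summable_on UNIV"
    by (rule summable_on_comparison_test[OF s]) (auto simp: proj_no_def proj_yes_def)
  show "proj_yes n \<psi> \<in> walk_space" "proj_no n \<psi> \<in> walk_space"
    using y o by (simp_all add: walk_space_def)
  have "(norm (\<psi> m))\<^sup>2 = (norm (proj_yes n \<psi> m))\<^sup>2 + (norm (proj_no n \<psi> m))\<^sup>2" for m
    by (simp add: proj_yes_def proj_no_def)
  then show "(walk_norm \<psi>)\<^sup>2 = (walk_norm (proj_yes n \<psi>))\<^sup>2 + (walk_norm (proj_no n \<psi>))\<^sup>2"
    by (simp add: walk_norm_def infsum_nonneg infsum_add[OF y o])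
qed

lemma initial_state_space:
  shows "initial_state \<alpha> \<beta> \<gamma> \<in> walk_space"
    and "(walk_norm (initial_state \<alpha> \<beta> \<gamma>))\<^sup>2 = (cmod \<alpha>)\<^sup>2 + (cmod \<beta>)\<^sup>2 + (cmod \<gamma>)\<^sup>2"
proof -
  let ?s = "(cmod \<alpha>)\<^sup>2 + (cmod \<beta>)\<^sup>2 + (cmod \<gamma>)\<^sup>2"
  have "(norm (initial_state \<alpha> \<beta> \<gamma> m))\<^sup>2 = (if m \<in> {0} then ?s else 0)" for m
    by (simp add: initial_state_def ket_def norm_coin axis_def)
  moreover have "((\<lambda>m::int. if m \<in> {0} then ?s else 0) has_sum ?s) UNIV"
    using has_sum_finite[of "{0::int}" "\<lambda>_. ?s"]
    by (subst has_sum_cong_neutral[where T = "{0}" and g = "\<lambda>_. ?s"]) auto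
  ultimately have h: "((\<lambda>m. (norm (initial_state \<alpha> \<beta> \<gamma> m))\<^sup>2) has_sum ?s) UNIV"
    by simp
  then show "initial_state \<alpha> \<beta> \<gamma> \<in> walk_space"
    unfolding walk_space_def by (auto dest: has_sum_imp_summable)
  show "(walk_norm (initial_state \<alpha> \<beta> \<gamma>))\<^sup>2 = ?s"
    unfolding walk_norm_def infsumI[OF h] by simp
qed

lemma left_absorption_summable:
  "(\<lambda>t. (walk_norm (proj_yes (- int M)
      (evolution ((no_step M N ^^ (t - 1)) (initial_state \<alpha> \<beta> \<gamma>)))))\<^sup>2) summable_on {1..}"
proof -
  define \<phi> where "\<phi> t = (no_step M N ^^ t) (initial_state \<alpha> \<beta> \<gamma>)" for t
  define a where "a t = (walk_norm (proj_yes (- int M) (evolution (\<phi> t))))\<^sup>2" for t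
  have a_nonneg: "0 \<le> a t" for t
    by (simp add: a_def)
  have space: "\<phi> t \<in> walk_space" for t
    by (induction t)
       (simp_all add: \<phi>_def no_step_def initial_state_space proj_pythagoras evolution_isometry)
  have step: "a t + (walk_norm (\<phi> (Suc t)))\<^sup>2 \<le> (walk_norm (\<phi> t))\<^sup>2" for t
  proof -
    let ?e = "evolution (\<phi> t)"
    have e: "?e \<in> walk_space" by (rule evolution_isometry[OF space])
    have "\<phi> (Suc t) = proj_no (int N) (proj_no (- int M) ?e)"
      by (simp add: \<phi>_def no_step_def)
    then show ?thesis
      using proj_pythagoras(3)[OF e, of "- int M"]
        proj_pythagoras(3)[OF proj_pythagoras(2)[OF e, of "- int M"], of "int N"]
        evolution_isometry(2)[OF space[of t]]
      by (simp add: a_def)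
  qed
  have bound: "sum a {..<n} + (walk_norm (\<phi> n))\<^sup>2 \<le> (walk_norm (\<phi> 0))\<^sup>2" for n
  proof (induction n)
    case (Suc n)
    then show ?case using step[of n] by simp
  qed simp
  have "summable a"
  proof (rule summableI_nonneg_bounded)
    show "0 \<le> a n" for n by (rule a_nonneg)
    show "sum a {..<n} \<le> (walk_norm (\<phi> 0))\<^sup>2" for n
      using bound[of n] by (smt (verit) zero_le_power2)
  qed
  then have "a summable_on UNIV"
    by (intro norm_summable_imp_summable_on) (use a_nonneg in simp)
  moreover have "bij_betw (\<lambda>t::nat. t - 1) {1..} UNIV"
    by (rule bij_betw_byWitness[where f' = Suc]) auto
  ultimately have "(\<lambda>t. a (t - 1)) summable_on {1..}"
    using summable_on_reindex_bij_betw by blast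
  then show ?thesis
    by (simp add: a_def \<phi>_def)
qed

end

theory Submission
  imports Defs
begin

text \<open>Let $f(z)$ be the generating function of the amplitudes absorbed at $-1$, so that the
  absorbing probability is the mean of $|f|^2$ over the unit circle. Transfer matrices give
  $f = p/q$, where $p$ and $q$ are Chebyshev polynomials in $x = 2 + 3\cos\theta$, up to simple
  factors. On the circle $|p/q|^2$ is the real part of a series $v/q$ that is regular in the
  disc, and hence the probability is $v(0)/q(0)$. Solving the Bezout equation for $v$ brings
  in the node $x = 3$ and gives the value $2 U_{N-1}(3) / T_N(3)$; the recurrence is
  then that of the Chebyshev polynomials at $3$.\<close>

section \<open>Square-summable power series\<close>

definition sq_summable :: "real fps \<Rightarrow> bool" where
  "sq_summable f \<longleftrightarrow> summable (\<lambda>n. (fps_nth f n)\<^sup>2)"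

text \<open>With real coefficients this is the mean of f(z) g(1/z) over the unit circle, so
  \<open>pairing f f\<close> is the mean of |f|^2.\<close>

definition pairing :: "real fps \<Rightarrow> real fps \<Rightarrow> real" where
  "pairing f g = (\<Sum>n. fps_nth f n * fps_nth g n)"

lemma sq_summable_add:
  assumes "sq_summable f" "sq_summable g"
  shows "sq_summable (f + g)"
  unfolding sq_summable_def
proof (rule summable_comparison_test')
  show "summable (\<lambda>n. 2 * (fps_nth f n)\<^sup>2 + 2 * (fps_nth g n)\<^sup>2)"
    using assms unfolding sq_summable_def by (intro summable_add summable_mult)
  show "norm ((fps_nth (f + g) n)\<^sup>2) \<le> 2 * (fps_nth f n)\<^sup>2 + 2 * (fps_nth g n)\<^sup>2" for n
    using zero_le_power2[of "fps_nth f n - fps_nth g n"] zero_le_power2[of "fps_nth f n + fps_nth g n"]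
    unfolding real_norm_def abs_of_nonneg[OF zero_le_power2] fps_add_nth power2_sum power2_diff by linarith
qed

lemma sq_summable_const_mult:
  assumes "sq_summable f"
  shows "sq_summable (fps_const c * f)"
  using assms unfolding sq_summable_def by (simp add: power_mult_distrib summable_mult)

lemma sq_summable_X_mult [simp]: "sq_summable (fps_X * f) \<longleftrightarrow> sq_summable f"
  unfolding sq_summable_def
  by (subst summable_Suc_iff[symmetric]) simp

lemma sq_summable_X_power_mult [simp]: "sq_summable (fps_X ^ n * f) \<longleftrightarrow> sq_summable f"
  by (induction n) (simp_all add: mult.assoc)

lemma summable_pairing:
  assumes "sq_summable f" "sq_summable g"
  shows "summable (\<lambda>n. fps_nth f n * fps_nth g n)"
proof (rule summable_comparison_test')
  show "summable (\<lambda>n. (fps_nth f n)\<^sup>2 + (fps_nth g n)\<^sup>2)"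
    using assms unfolding sq_summable_def by (rule summable_add)
  fix n
  have "2 * \<bar>fps_nth f n * fps_nth g n\<bar> \<le> (fps_nth f n)\<^sup>2 + (fps_nth g n)\<^sup>2"
    using zero_le_power2[of "\<bar>fps_nth f n\<bar> - \<bar>fps_nth g n\<bar>"]
    by (simp add: power2_diff abs_mult)
  then show "norm (fps_nth f n * fps_nth g n) \<le> (fps_nth f n)\<^sup>2 + (fps_nth g n)\<^sup>2"
    using abs_ge_zero[of "fps_nth f n * fps_nth g n"] unfolding real_norm_def by linarith
qed

lemma pairing_commute: "pairing f g = pairing g f"
  by (simp add: pairing_def mult.commute)

lemma pairing_add_left:
  assumes "sq_summable f" "sq_summable g" "sq_summable k"
  shows "pairing (f + g) k = pairing f k + pairing g k"
  using suminf_add[OF summable_pairing[OF assms(1,3)] summable_pairing[OF assms(2,3)]]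
  by (simp add: pairing_def algebra_simps)

lemma pairing_add_right:
  assumes "sq_summable f" "sq_summable g" "sq_summable k"
  shows "pairing k (f + g) = pairing k f + pairing k g"
  using pairing_add_left[OF assms] by (simp add: pairing_commute)

lemma pairing_const_left:
  assumes "sq_summable f" "sq_summable g"
  shows "pairing (fps_const c * f) g = c * pairing f g"
  using suminf_mult[OF summable_pairing[OF assms], of c]
  by (simp add: pairing_def mult.assoc)

lemma pairing_const_right:
  assumes "sq_summable f" "sq_summable g"
  shows "pairing f (fps_const c * g) = c * pairing f g"
  using pairing_const_left[OF assms(2,1)] by (simp add: pairing_commute)

lemma pairing_X_mult:
  assumes "sq_summable f" "sq_summable g"
  shows "pairing (fps_X * f) (fps_X * g) = pairing f g"
proof -
  have "summable (\<lambda>n. fps_nth (fps_X * f) n * fps_nth (fps_X * g) n)"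
    using assms by (intro summable_pairing) simp_all
  from suminf_split_head[OF this] show ?thesis
    by (simp add: pairing_def)
qed

lemma pairing_one_right: "pairing f 1 = fps_nth f 0"
proof -
  have "(\<Sum>n. fps_nth f n * fps_nth 1 n) = (\<Sum>n\<in>{0}. fps_nth f n * fps_nth 1 n)"
    by (rule suminf_finite) auto
  then show ?thesis by (simp add: pairing_def)
qed

section \<open>Reciprocal polynomials as adjoints\<close>

text \<open>For a polynomial $g$ of degree at most $n$ the relation holds with
  $g'(z) = z^n g(1/z)$.\<close>

definition reciprocal :: "nat \<Rightarrow> real fps \<Rightarrow> real fps \<Rightarrow> bool" where
  "reciprocal n g g' \<longleftrightarrow>
     (\<forall>a. sq_summable a \<longrightarrow> sq_summable (g * a) \<and> sq_summable (g' * a)) \<and>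
     (\<forall>a b. sq_summable a \<longrightarrow> sq_summable b \<longrightarrow>
        pairing (g' * a) (fps_X ^ n * b) = pairing a (g * b))"

lemma reciprocal_sq_summable:
  assumes "reciprocal n g g'" "sq_summable a"
  shows "sq_summable (g * a)" "sq_summable (g' * a)"
  using assms by (simp_all add: reciprocal_def)

lemma reciprocal_pairing:
  assumes "reciprocal n g g'" "sq_summable a" "sq_summable b"
  shows "pairing (g' * a) (fps_X ^ n * b) = pairing a (g * b)"
  using assms by (simp add: reciprocal_def)

lemma reciprocal_const: "reciprocal 0 (fps_const c) (fps_const c)"
  by (simp add: reciprocal_def sq_summable_const_mult pairing_const_left pairing_const_right)

lemma reciprocal_X_one: "reciprocal 1 fps_X 1"
  by (simp add: reciprocal_def)

lemma reciprocal_one_X: "reciprocal 1 1 fps_X"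
  by (simp add: reciprocal_def pairing_X_mult)

lemma reciprocal_add:
  assumes "reciprocal n g g'" "reciprocal n k k'"
  shows "reciprocal n (g + k) (g' + k')"
  using assms
  by (simp add: reciprocal_def distrib_right sq_summable_add pairing_add_left pairing_add_right)

text \<open>The factors are moved across the pairing one after the other, each using up its own
  power of \<open>fps_X\<close>.\<close>

lemma reciprocal_mult:
  assumes g: "reciprocal n g g'" and k: "reciprocal m k k'"
  shows "reciprocal (n + m) (g * k) (g' * k')"
  unfolding reciprocal_def
proof (intro conjI allI impI)
  fix a b assume a: "sq_summable a"
  show "sq_summable (g * k * a)" "sq_summable (g' * k' * a)"
    using reciprocal_sq_summable[OF g] reciprocal_sq_summable[OF k] a by (simp_all add: mult.assoc)
  assume b: "sq_summable b"
  have "pairing (g' * k' * a) (fps_X ^ (n + m) * b)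
      = pairing (g' * (k' * a)) (fps_X ^ n * (fps_X ^ m * b))"
    by (simp add: mult.assoc power_add)
  also have "\<dots> = pairing (k' * a) (g * (fps_X ^ m * b))"
    using reciprocal_sq_summable[OF k a] b by (intro reciprocal_pairing[OF g]) simp_all
  also have "\<dots> = pairing (k' * a) (fps_X ^ m * (g * b))"
    by (simp add: mult.left_commute)
  also have "\<dots> = pairing a (k * (g * b))"
    using reciprocal_sq_summable[OF g b] a by (intro reciprocal_pairing[OF k]) simp_all
  finally show "pairing (g' * k' * a) (fps_X ^ (n + m) * b) = pairing a (g * k * b)"
    by (simp add: ac_simps)
qed

lemma reciprocal_const_mult:
  assumes "reciprocal n g g'"
  shows "reciprocal n (fps_const c * g) (fps_const c * g')"
  using reciprocal_mult[OF reciprocal_const assms] by simp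

lemma reciprocal_uminus:
  assumes "reciprocal n g g'"
  shows "reciprocal n (- g) (- g')"
  using reciprocal_const_mult[OF assms, of "-1"] by (simp flip: fps_const_neg)

lemma reciprocal_diff:
  assumes "reciprocal n g g'" "reciprocal n k k'"
  shows "reciprocal n (g - k) (g' - k')"
  using reciprocal_add[OF assms(1) reciprocal_uminus[OF assms(2)]] by simp

text \<open>The index is half the degree: for a polynomial g, z^(-n) g(z) is then invariant under z
  -> 1/z and hence real on the unit circle. Polynomials of degree at most n in x, multiplied by z^n,
  are of this kind.\<close>

abbreviation palindromic :: "nat \<Rightarrow> real fps \<Rightarrow> bool" where
  "palindromic n g \<equiv> reciprocal (2 * n) g g"

lemma palindromic_mult:
  assumes "palindromic n g" "palindromic m k"
  shows "palindromic (n + m) (g * k)"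
  using reciprocal_mult[OF assms] by (simp add: algebra_simps)

lemma palindromic_one: "palindromic 0 1"
  using reciprocal_const[of 1] by simp

lemma palindromic_X: "palindromic 1 fps_X"
  using reciprocal_mult[OF reciprocal_X_one reciprocal_one_X] by (simp add: numeral_2_eq_2)

lemma palindromic_X_power: "palindromic n (fps_X ^ n)"
proof (induction n)
  case 0
  then show ?case using palindromic_one by simp
next
  case (Suc n)
  then show ?case using palindromic_mult[OF palindromic_X Suc] by simp
qed

text \<open>If $v q^* + v^* q = 2 p p^*$, then $|p/q|^2$ is the real part of $v/q$ on the unit
  circle, so its mean is the value of $v/q$ at the origin.\<close>

lemma pairing_quotient:
  assumes q: "reciprocal n q q'" and p: "reciprocal n p p'" and v: "reciprocal n v v'"
    and h: "sq_summable h" "q * h = 1"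
    and eq: "v * q' + v' * q = 2 * (p * p')"
  shows "pairing (p * h) (p * h) = fps_nth v 0 / fps_nth q 0"
proof -
  note sq = reciprocal_sq_summable
  let ?z = "fps_X ^ n * h"
  have z: "sq_summable ?z" using h by simp
  \<comment> \<open>Adjointness moves one factor p to the other side as p', where it meets the
    second p and makes \<open>eq\<close> applicable.\<close>
  have "2 * pairing (p * h) (p * h) = 2 * pairing (p' * (p * h)) ?z"
    using reciprocal_pairing[OF p sq(1)[OF p h(1)] h(1)] by simp
  also have "\<dots> = pairing (fps_const 2 * (p' * (p * h))) ?z"
    using pairing_const_left sq(2)[OF p sq(1)[OF p h(1)]] z by simp
  also have "fps_const 2 * (p' * (p * h)) = 2 * (p * p') * h"
    by (simp add: numeral_fps_const ac_simps)
  also have "\<dots> = q' * (v * h) + v' * (q * h)"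
    unfolding eq[symmetric] by (simp add: algebra_simps)
  also have "pairing \<dots> ?z = pairing (q' * (v * h)) ?z + pairing (v' * (q * h)) ?z"
    using sq[OF q sq(1)[OF v h(1)]] sq[OF v sq(1)[OF q h(1)]] z by (intro pairing_add_left)
  \<comment> \<open>Adjointness used backwards removes q' and v'. Both terms become the pairing of
    \<open>v * h\<close> with \<open>q * h = 1\<close>, which reads off a constant
    coefficient.\<close>
  also have "\<dots> = pairing (v * h) (q * h) + pairing (q * h) (v * h)"
    using reciprocal_pairing[OF q sq(1)[OF v h(1)] h(1)]
      reciprocal_pairing[OF v sq(1)[OF q h(1)] h(1)] by simp
  also have "\<dots> = 2 * fps_nth (v * h) 0"
    using h(2) pairing_one_right[of "v * h"] pairing_commute[of 1 "v * h"] by simp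
  finally have "pairing (p * h) (p * h) = fps_nth v 0 * fps_nth h 0" by simp
  moreover have "fps_nth q 0 * fps_nth h 0 = 1"
    using arg_cong[OF h(2), of "\<lambda>f. fps_nth f 0"] by simp
  ultimately show ?thesis
    by (metis divide_inverse inverse_unique)
qed

section \<open>Homogenised Chebyshev polynomials\<close>

text \<open>In the variable $x = (3z^{-1} + 4 + 3z)/2$, half the trace of the normalised transfer
  matrix of one site, \<open>cheb_T n\<close> and \<open>cheb_U n\<close> are $z^n T_n(x)$ and $z^{n-1} U_{n-1}(x)$, and
  \<open>half_trace\<close> is $zx$.\<close>

definition half_trace :: "real fps" where
  "half_trace = fps_const (1/2) * (3 + 4 * fps_X + 3 * fps_X\<^sup>2)"

fun cheb_T cheb_U :: "nat \<Rightarrow> real fps" where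
  "cheb_T 0 = 1"
| "cheb_U 0 = 0"
| "cheb_T (Suc n) = half_trace * cheb_T n + (half_trace\<^sup>2 - fps_X\<^sup>2) * cheb_U n"
| "cheb_U (Suc n) = cheb_T n + half_trace * cheb_U n"

declare cheb_T.simps(2) [simp del] cheb_U.simps(2) [simp del]

lemmas cheb_Suc = cheb_T.simps(2) cheb_U.simps(2)

lemma two_half_trace: "2 * half_trace = 3 + 4 * fps_X + 3 * fps_X\<^sup>2"
  by (simp add: half_trace_def numeral_fps_const flip: mult.assoc)

lemma half_trace_nth_0: "fps_nth half_trace 0 = 3 / 2"
  using arg_cong[OF two_half_trace, of "\<lambda>f. fps_nth f 0"]
  by (simp add: fps_power_zeroth)

lemma palindromic_half_trace: "palindromic 1 half_trace"
proof -
  have "palindromic 1 (1 + fps_X\<^sup>2)"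
    using reciprocal_add[OF reciprocal_mult[OF reciprocal_one_X reciprocal_one_X]
        reciprocal_mult[OF reciprocal_X_one reciprocal_X_one]]
    by (simp add: power2_eq_square add.commute numeral_2_eq_2)
  from reciprocal_add[OF reciprocal_const_mult[OF this, of "3/2"]
      reciprocal_const_mult[OF palindromic_X, of 2]]
  show ?thesis
    by (simp add: half_trace_def numeral_fps_const distrib_left add.commute add.left_commute flip: mult.assoc)
qed

text \<open>Let A be the negative of the one-site transfer matrix in \<open>transfer_step\<close>;
  it has determinant 1 and trace 2x. By Cayley-Hamilton its n-th power is T_n(x) I + U_{n-1}(x) (A -
  x I). \<open>denom n\<close> and \<open>numer n\<close> are the first column of that power times
  z^n (1 - z), with (3 + z) - (1 - z) zx rewritten as (1 + z)(zx - 3z).\<close>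

definition denom :: "nat \<Rightarrow> real fps" where
  "denom n = (1 - fps_X) * cheb_T n + (1 + fps_X) * (half_trace - 3 * fps_X) * cheb_U n"

definition numer :: "nat \<Rightarrow> real fps" where
  "numer n = 2 * fps_X * (1 + fps_X) * cheb_U n"

text \<open>One further transfer step on the column (\<open>denom\<close>, \<open>numer\<close>),
  multiplied by 1 - z to stay within polynomials; \<open>numer_Suc\<close> is the second
  row.\<close>

lemma denom_Suc:
  "(1 - fps_X) * denom (Suc n) = (3 + fps_X) * denom n - 2 * fps_X * (1 + fps_X) * numer n"
proof -
  have "(1 - z) * ((1 - z) * (x * t + (x\<^sup>2 - z\<^sup>2) * u) + (1 + z) * (x - 3 * z) * (t + x * u))
      = (3 + z) * ((1 - z) * t + (1 + z) * (x - 3 * z) * u)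
        - 2 * z * (1 + z) * (2 * z * (1 + z) * u)"
    if "2 * x = 3 + 4 * z + 3 * z\<^sup>2" for x z t u :: "real fps"
    using that by algebra
  then show ?thesis using two_half_trace by (simp add: denom_def numer_def cheb_Suc)
qed

lemma numer_Suc:
  "(1 - fps_X) * numer (Suc n) = 2 * fps_X * (1 + fps_X) * denom n - fps_X\<^sup>2 * (3 * fps_X + 1) * numer n"
proof -
  have "(1 - z) * (2 * z * (1 + z) * (t + x * u))
      = 2 * z * (1 + z) * ((1 - z) * t + (1 + z) * (x - 3 * z) * u)
        - z\<^sup>2 * (3 * z + 1) * (2 * z * (1 + z) * u)"
    if "2 * x = 3 + 4 * z + 3 * z\<^sup>2" for x z t u :: "real fps"
    using that by algebra
  then show ?thesis using two_half_trace by (simp add: denom_def numer_def cheb_Suc)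
qed

text \<open>Polynomials in x inherit the symmetry of x under z -> 1/z. The induction starts at
  \<open>Suc n\<close> because the degree in x of the second kind is one lower.\<close>

lemma palindromic_cheb: "palindromic (Suc n) (cheb_T (Suc n)) \<and> palindromic n (cheb_U (Suc n))"
proof (induction n)
  case 0
  then show ?case using palindromic_half_trace palindromic_one by (simp add: cheb_Suc)
next
  case (Suc n)
  have "palindromic 2 (half_trace\<^sup>2 - fps_X\<^sup>2)"
    using reciprocal_diff[OF palindromic_mult[OF palindromic_half_trace palindromic_half_trace]
        palindromic_mult[OF palindromic_X palindromic_X]]
    by (simp add: power2_eq_square numeral_2_eq_2)
  from palindromic_mult[OF this conjunct2[OF Suc]] palindromic_mult[OF palindromic_half_trace conjunct1[OF Suc]]
    palindromic_mult[OF palindromic_half_trace conjunct2[OF Suc]] Suc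
  show ?case
    by (simp add: cheb_Suc(1)[of "Suc n"] cheb_Suc(2)[of "Suc n"] reciprocal_add)
qed

section \<open>Values at the node $x = 3$\<close>

text \<open>T_n(3) and U_{n-1}(3): the recursion of \<open>cheb_T\<close> and \<open>cheb_U\<close>
  with x = 3, where x^2 - 1 = 8.\<close>

fun node_T node_U :: "nat \<Rightarrow> real" where
  "node_T 0 = 1"
| "node_U 0 = 0"
| "node_T (Suc n) = 3 * node_T n + 8 * node_U n"
| "node_U (Suc n) = node_T n + 3 * node_U n"

declare node_T.simps(2) [simp del] node_U.simps(2) [simp del]

lemmas node_Suc = node_T.simps(2) node_U.simps(2)

lemma node_nonneg: "0 < node_T n \<and> 0 \<le> node_U n"
  by (induction n) (auto simp: node_Suc)

definition node_ratio :: "nat \<Rightarrow> real" where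
  "node_ratio n = 2 * node_U n / node_T n"

lemma node_ratio_Suc: "node_ratio (Suc n) = (2 + 3 * node_ratio n) / (3 + 4 * node_ratio n)"
proof -
  have "0 < node_T n" "0 < 3 * node_T n + 8 * node_U n"
    using node_nonneg[of n] by auto
  then show ?thesis
    by (simp add: node_ratio_def node_Suc divide_simps)
qed

text \<open>Homogenised division by x - 3: the remainder is the value at the node and the quotient
  is again a polynomial in x, hence palindromic. The factor \<open>fps_X\<close> brings the second
  kind to the degree of the first.\<close>

lemma cheb_node_remainder:
  "\<exists>d e. palindromic n d \<and> palindromic n e \<and>
     cheb_T (Suc n) = fps_const (node_T (Suc n)) * fps_X ^ Suc n + (half_trace - 3 * fps_X) * d \<and>
     fps_X * cheb_U (Suc n) = fps_const (node_U (Suc n)) * fps_X ^ Suc n + (half_trace - 3 * fps_X) * e"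
proof (induction n)
  case 0
  have "palindromic 0 0" using reciprocal_const[of 0] by simp
  with palindromic_one show ?case
    by (rule_tac exI[of _ 1], rule_tac exI[of _ 0]) (simp add: numeral_fps_const cheb_Suc node_Suc)
next
  case (Suc n)
  then obtain d e where de: "palindromic n d" "palindromic n e"
    "cheb_T (Suc n) = fps_const (node_T (Suc n)) * fps_X ^ Suc n + (half_trace - 3 * fps_X) * d"
    "fps_X * cheb_U (Suc n) = fps_const (node_U (Suc n)) * fps_X ^ Suc n + (half_trace - 3 * fps_X) * e"
    by blast
  define z where "z = (fps_X :: real fps)"
  let ?c = "fps_const (node_T (Suc n)) * z ^ Suc n"
  let ?u = "fps_const (node_U (Suc n)) * z ^ Suc n"
  \<comment> \<open>With x for \<open>half_trace\<close>, the new quotients come from splitting x =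
    3z + (x - 3z) in front of the old remainders and x^2 - z^2 = 8 z^2 + (x - 3z)(x + 3z) in front
    of \<open>cheb_U\<close>.\<close>
  define d' where "d' = ?c + half_trace * d + fps_const 8 * (z * e) + (half_trace + fps_const 3 * z) * cheb_U (Suc n)"
  define e' where "e' = z * d + ?u + half_trace * e"
  have pal: "palindromic (Suc n) (fps_const c * z ^ Suc n)" "palindromic (Suc n) (half_trace * d)"
      "palindromic (Suc n) (z * d)" "palindromic (Suc n) (z * e)" "palindromic (Suc n) (half_trace * e)" 
      "palindromic (Suc n) ((half_trace + fps_const 3 * z) * cheb_U (Suc n))" for c
    using reciprocal_const_mult[OF palindromic_X_power[of "Suc n"]] palindromic_mult[OF palindromic_half_trace de(1)]
      palindromic_mult[OF palindromic_half_trace de(2)] palindromic_mult[OF palindromic_X de(1)]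
      palindromic_mult[OF palindromic_X de(2)]
      palindromic_mult[OF reciprocal_add[OF palindromic_half_trace reciprocal_const_mult[OF palindromic_X, of 3]] conjunct2[OF palindromic_cheb[of n]]]
    unfolding z_def by simp_all
  have "palindromic (Suc n) d'" "palindromic (Suc n) e'"
    unfolding d'_def e'_def by (intro reciprocal_add reciprocal_const_mult pal)+
  have node: "fps_const (node_T (Suc (Suc n))) * z ^ Suc (Suc n) = 3 * z * ?c + 8 * z * ?u"
    "fps_const (node_U (Suc (Suc n))) * z ^ Suc (Suc n) = z * ?c + 3 * z * ?u"
    unfolding node_Suc(1)[of "Suc n"] node_Suc(2)[of "Suc n"]
    by (simp_all add: numeral_fps_const algebra_simps flip: fps_const_add fps_const_mult)
  have "cheb_T (Suc (Suc n)) = fps_const (node_T (Suc (Suc n))) * z ^ Suc (Suc n) + (half_trace - 3 * z) * d'"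
  proof -
    have "x * (c + (x - 3 * z) * d) + (x\<^sup>2 - z\<^sup>2) * v
        = 3 * z * c + 8 * z * u + (x - 3 * z) * (c + x * d + 8 * (z * e) + (x + 3 * z) * v)"
      if "z * v = u + (x - 3 * z) * e" for x c v u d e :: "real fps"
      using that by algebra
    from this[OF de(4)[folded z_def]] show ?thesis
      unfolding node cheb_Suc(1)[of "Suc n", folded z_def] de(3)[folded z_def] d'_def
        numeral_fps_const[symmetric] .
  qed
  moreover have "z * cheb_U (Suc (Suc n)) = fps_const (node_U (Suc (Suc n))) * z ^ Suc (Suc n) + (half_trace - 3 * z) * e'"
  proof -
    have "z * ((c + (x - 3 * z) * d) + x * v)
        = z * c + 3 * z * u + (x - 3 * z) * (z * d + u + x * e)"
      if "z * v = u + (x - 3 * z) * e" for x c v u d e :: "real fps"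
      using that by algebra
    from this[OF de(4)[folded z_def]] show ?thesis
      unfolding node cheb_Suc(2)[of "Suc n", folded z_def] de(3)[folded z_def] e'_def
        numeral_fps_const[symmetric] .
  qed
  ultimately show ?case using \<open>palindromic (Suc n) d'\<close> \<open>palindromic (Suc n) e'\<close>
    unfolding z_def by blast
qed

text \<open>At z = 0 the term \<open>fps_X\<close> squared drops out of the recursion and the ratio
  3/2 reproduces itself. This makes \<open>denom\<close> invertible and evaluates v/q at the
  origin.\<close>

lemma cheb_nth_0:
  "0 < fps_nth (cheb_U (Suc n)) 0 \<and> fps_nth (cheb_T (Suc n)) 0 = 3 / 2 * fps_nth (cheb_U (Suc n)) 0"
proof (induction n)
  case 0
  then show ?case by (simp add: cheb_Suc half_trace_nth_0 power2_eq_square)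
next
  case (Suc n)
  then show ?case
    by (simp add: cheb_Suc(1)[of "Suc n"] cheb_Suc(2)[of "Suc n"] half_trace_nth_0 power2_eq_square)
qed

lemma denom_nth_0: "fps_nth (denom (Suc n)) 0 = 2 * fps_nth (cheb_T (Suc n)) 0"
  using cheb_nth_0[of n] by (simp add: denom_def half_trace_nth_0)

text \<open>\<open>pairing_quotient\<close> is applied with p = \<open>numer\<close>, its own
  reciprocal, and v = (1 - z) A + (1 + z) B with A, B palindromic. The condition on v becomes (1 +
  z)^2 (x - 3z) U B - (1 - z)^2 A T = (2z (1 + z) U)^2. For A = r (x + z) U, evaluation at x = 3z
  forces r to be the node ratio.\<close>

lemma pairing_numer_denom:
  assumes h: "sq_summable h" "denom (Suc n) * h = 1"
  shows "pairing (numer (Suc n) * h) (numer (Suc n) * h) = node_ratio (Suc n)"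
proof -
  define z where "z = (fps_X :: real fps)"
  define x where "x = half_trace"
  define T where "T = cheb_T (Suc n)"
  define U where "U = cheb_U (Suc n)"
  define r where "r = node_ratio (Suc n)"
  define P where "P = fps_const r"
  obtain d e where d: "palindromic n d" and e: "palindromic n e"
    and Td: "T = fps_const (node_T (Suc n)) * z ^ Suc n + (x - 3 * z) * d"
    and Ue: "z * U = fps_const (node_U (Suc n)) * z ^ Suc n + (x - 3 * z) * e"
    unfolding T_def U_def x_def z_def using cheb_node_remainder[of n] by blast
  \<comment> \<open>The quotient of (x - z) U - r T by x - 3z; the division is exact because r makes
    this expression vanish at x = 3z.\<close>
  define b where "b = U + fps_const 2 * e - P * d"
  have "r * node_T (Suc n) = 2 * node_U (Suc n)"
    using node_nonneg[of "Suc n"] by (simp add: r_def node_ratio_def)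
  then have Pc: "P * (fps_const (node_T (Suc n)) * z ^ Suc n) = 2 * (fps_const (node_U (Suc n)) * z ^ Suc n)"
    by (simp add: P_def numeral_fps_const flip: mult.assoc)
  have b: "(x - 3 * z) * b = (x - z) * U - P * T"
  proof -
    have "(x - 3 * z) * (U + 2 * e - P * d) = (x - z) * U - P * T"
      if "P * c = 2 * u" "T = c + (x - 3 * z) * d" "z * U = u + (x - 3 * z) * e" for c u
      using that by algebra
    then show ?thesis
      using Pc Td Ue unfolding b_def numeral_fps_const[symmetric] by blast
  qed
  have pal: "palindromic (Suc n) T" "palindromic n U" "palindromic n b"
      "palindromic 1 (x + fps_const c * z)" for c
    using palindromic_cheb[of n] d e unfolding T_def U_def b_def P_def x_def z_def
    by (blast intro: reciprocal_add reciprocal_diff reciprocal_const_mult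
        palindromic_half_trace palindromic_X)+
  have rec1: "reciprocal 1 (1 - z) (z - 1)" "reciprocal 1 (1 + z) (1 + z)"
    using reciprocal_diff[OF reciprocal_one_X reciprocal_X_one]
      reciprocal_add[OF reciprocal_one_X reciprocal_X_one]
    by (simp_all add: z_def add.commute)
  \<comment> \<open>Reversal turns 1 - z into z - 1 and fixes 1 + z, so only the first summand of
    \<open>denom\<close> changes sign; v' arises from v in the same way.\<close>
  define q' where "q' = (z - 1) * T + (1 + z) * ((x + fps_const (-3) * z) * U)"
  define v where "v = (1 - z) * (P * ((x + fps_const 1 * z) * U))
      + (1 + z) * ((x + fps_const (-3) * z) * U - (x + fps_const (-5) * z) * b)"
  define v' where "v' = (z - 1) * (P * ((x + fps_const 1 * z) * U))
      + (1 + z) * ((x + fps_const (-3) * z) * U - (x + fps_const (-5) * z) * b)"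
  have neg: "fps_const (-3) = (- 3 :: real fps)" "fps_const (-5) = (- 5 :: real fps)"
    by (simp_all add: numeral_fps_const)
  have q: "denom (Suc n) = (1 - z) * T + (1 + z) * ((x + fps_const (-3) * z) * U)"
    by (simp add: denom_def z_def x_def T_def U_def mult.assoc neg)
  have p: "numer (Suc n) = (1 + z) * (fps_const 2 * (z * U))"
    by (simp add: numer_def z_def U_def numeral_fps_const ac_simps)
  have deg: "1 + 2 * Suc n = Suc (2 * Suc n)" "1 + 2 * (1 + n) = Suc (2 * Suc n)" by simp_all
  note comb = reciprocal_mult[where n = 1 and m = "2 * Suc n", unfolded deg]
  have pal': "palindromic (Suc n) ((x + fps_const c * z) * k)" "palindromic (Suc n) (z * k)"
    if "palindromic n k" for c k
    using palindromic_mult[OF pal(4) that] palindromic_mult[OF palindromic_X that]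
    by (simp_all add: z_def)
  have rq: "reciprocal (Suc (2 * Suc n)) (denom (Suc n)) q'"
    unfolding q q'_def by (intro reciprocal_add comb rec1 pal pal')
  have rp: "reciprocal (Suc (2 * Suc n)) (numer (Suc n)) (numer (Suc n))"
    unfolding p by (intro comb rec1 reciprocal_const_mult pal pal')
  have rv: "reciprocal (Suc (2 * Suc n)) v v'"
    unfolding v_def v'_def P_def
    by (intro reciprocal_add reciprocal_diff comb rec1 reciprocal_const_mult pal pal')
  have x: "2 * x = 3 + 4 * z + 3 * z\<^sup>2"
    using two_half_trace by (simp add: x_def z_def)
  have "v * q' + v' * denom (Suc n)
      = 2 * ((1 + z)\<^sup>2 * ((x - 3 * z) * U) * ((x - 3 * z) * U - (x - 5 * z) * b)
             - (1 - z)\<^sup>2 * (x + z) * (P * U * T))"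
    unfolding q v_def v'_def q'_def neg by (simp add: power2_eq_square algebra_simps)
  \<comment> \<open>From the formula for 2x: (1 + z)^2 = 2 (x + z) / 3 and (1 - z)^2 = 2 (x - 5z) /
    3.\<close>
  also have "(1 - z)\<^sup>2 * (x + z) = (1 + z)\<^sup>2 * (x - 5 * z)"
    using x by algebra
  \<comment> \<open>After substituting for (x - 3z) b the terms in T cancel, and (x - 3z)^2 - (x -
    z)(x - 5z) = 4 z^2 remains.\<close>
  also have "2 * ((1 + z)\<^sup>2 * ((x - 3 * z) * U) * ((x - 3 * z) * U - (x - 5 * z) * b)
      - (1 + z)\<^sup>2 * (x - 5 * z) * (P * U * T)) = 2 * (2 * z * (1 + z) * U * (2 * z * (1 + z) * U))"
    using b by algebra
  finally have "v * q' + v' * denom (Suc n) = 2 * (numer (Suc n) * numer (Suc n))"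
    by (simp add: numer_def z_def U_def)
  from pairing_quotient[OF rq rp rv h this]
  have "pairing (numer (Suc n) * h) (numer (Suc n) * h) = fps_nth v 0 / fps_nth (denom (Suc n)) 0" .
  also have "fps_nth v 0 = r * fps_nth (denom (Suc n)) 0"
  proof -
    \<comment> \<open>At the origin x U = T, so x b = (1 - r) T and v = 2 r T there.\<close>
    have "3 / 2 * fps_nth b 0 = 3 / 2 * fps_nth U 0 - r * fps_nth T 0"
      using arg_cong[OF b, of "\<lambda>f. fps_nth f 0"]
      by (simp add: x_def z_def P_def half_trace_nth_0)
    moreover have "3 / 2 * fps_nth U 0 = fps_nth T 0"
      using cheb_nth_0[of n] by (simp add: U_def T_def)
    moreover have "fps_nth v 0 = r * (3 / 2 * fps_nth U 0) + (3 / 2 * fps_nth U 0 - 3 / 2 * fps_nth b 0)"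
      by (simp add: v_def P_def x_def z_def half_trace_nth_0)
    ultimately show ?thesis by (simp add: denom_nth_0 T_def algebra_simps)
  qed
  also have "r * fps_nth (denom (Suc n)) 0 / fps_nth (denom (Suc n)) 0 = r"
    using cheb_nth_0[of n] by (simp add: denom_nth_0)
  finally show ?thesis by (simp add: r_def)
qed

section \<open>Square-summability of the inverse denominator\<close>

text \<open>\<open>near_one c g\<close>: the polynomial \<open>g\<close> takes the value \<open>c\<close> at $z = 1$.\<close>

definition near_one :: "real \<Rightarrow> real fps \<Rightarrow> bool" where
  "near_one c g \<longleftrightarrow> (\<exists>k. (\<forall>a. sq_summable a \<longrightarrow> sq_summable (k * a)) \<and>
     g = fps_const c + (1 - fps_X) * k)"

lemma near_one_const: "near_one c (fps_const c)"
  unfolding near_one_def by (rule exI[of _ 0]) (simp add: sq_summable_def)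

lemma near_one_X: "near_one 1 fps_X"
  unfolding near_one_def
  by (rule exI[of _ "fps_const (-1)"]) (use sq_summable_const_mult[of _ "-1"] in \<open>simp flip: fps_const_neg\<close>)

lemma near_one_add:
  assumes "near_one c g" "near_one d k"
  shows "near_one (c + d) (g + k)"
proof -
  from assms obtain u v where u: "\<And>a. sq_summable a \<Longrightarrow> sq_summable (u * a)" "g = fps_const c + (1 - fps_X) * u"
    and v: "\<And>a. sq_summable a \<Longrightarrow> sq_summable (v * a)" "k = fps_const d + (1 - fps_X) * v"
    unfolding near_one_def by blast
  then show ?thesis
    unfolding near_one_def
    by (intro exI[of _ "u + v"]) (simp add: distrib_left distrib_right sq_summable_add ac_simps flip: fps_const_add)
qed

lemma near_one_mult:
  assumes "near_one c g" "near_one d k"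
  shows "near_one (c * d) (g * k)"
proof -
  from assms obtain u v where u: "\<And>a. sq_summable a \<Longrightarrow> sq_summable (u * a)" "g = fps_const c + (1 - fps_X) * u"
    and v: "\<And>a. sq_summable a \<Longrightarrow> sq_summable (v * a)" "k = fps_const d + (1 - fps_X) * v"
    unfolding near_one_def by blast
  \<comment> \<open>From expanding (c + (1 - z) u)(d + (1 - z) v); the last bracket is (1 - z) u
    v.\<close>
  let ?w = "fps_const c * v + fps_const d * u + (u * v + fps_const (-1) * (fps_X * (u * v)))"
  have "sq_summable (?w * a)" if "sq_summable a" for a
  proof -
    have "?w * a = fps_const c * (v * a) + fps_const d * (u * a)
        + (u * (v * a) + fps_const (-1) * (fps_X * (u * (v * a))))"
      by (simp add: algebra_simps)
    then show ?thesis
      using that u(1) v(1) by (simp only: sq_summable_add sq_summable_const_mult sq_summable_X_mult)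
  qed
  moreover have "g * k = fps_const (c * d) + (1 - fps_X) * ?w"
    unfolding u(2) v(2) by (simp add: algebra_simps flip: fps_const_mult fps_const_neg)
  ultimately show ?thesis unfolding near_one_def by blast
qed

lemma near_one_half_trace: "near_one 5 half_trace"
proof -
  have "near_one (1/2 * (3 + (4 * 1 + 3 * (1 * 1))))
      (fps_const (1/2) * (fps_const 3 + (fps_const 4 * fps_X + fps_const 3 * (fps_X * fps_X))))"
    by (intro near_one_add near_one_mult near_one_const near_one_X)
  then show ?thesis
    by (simp add: half_trace_def numeral_fps_const power2_eq_square add.assoc)
qed

text \<open>At z = 1 one has x = 5 and x^2 - 1 = 24, so the recursion has positive coefficients and
  no cancellation can occur.\<close>

lemma near_one_cheb: "\<exists>c d. 0 < c \<and> 0 \<le> d \<and> near_one c (cheb_T n) \<and> near_one d (cheb_U n)"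
proof (induction n)
  case 0
  show ?case
    using near_one_const[of 1] near_one_const[of 0] by (intro exI[of _ 1] exI[of _ 0]) simp
next
  case (Suc n)
  then obtain c d where cd: "0 < c" "0 \<le> d" "near_one c (cheb_T n)" "near_one d (cheb_U n)"
    by blast
  have "near_one (5 * 5 + -1 * (1 * 1)) (half_trace * half_trace + fps_const (-1) * (fps_X * fps_X))"
    by (intro near_one_add near_one_mult near_one_const near_one_X near_one_half_trace)
  then have "near_one 24 (half_trace\<^sup>2 - fps_X\<^sup>2)"
    by (simp add: power2_eq_square flip: fps_const_neg)
  then have "near_one (5 * c + 24 * d) (cheb_T (Suc n))"
    unfolding cheb_Suc by (intro near_one_add near_one_mult near_one_half_trace cd)
  moreover have "near_one (c + 5 * d) (cheb_U (Suc n))"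
    unfolding cheb_Suc by (intro near_one_add near_one_mult near_one_half_trace cd)
  ultimately show ?case using cd by (metis add_pos_nonneg add_nonneg_nonneg less_imp_le mult_nonneg_nonneg mult_pos_pos zero_le_numeral zero_less_numeral)
qed

lemma near_one_numer: "\<exists>c. c > 0 \<and> near_one c (numer (Suc n))"
proof -
  obtain c d where cd: "0 < c" "0 \<le> d" "near_one c (cheb_T n)" "near_one d (cheb_U n)"
    using near_one_cheb by blast
  have "near_one (2 * 1 * (1 + 1) * (c + 5 * d)) (fps_const 2 * fps_X * (fps_const 1 + fps_X) * cheb_U (Suc n))"
    unfolding cheb_Suc
    by (intro near_one_add near_one_mult near_one_const near_one_X near_one_half_trace cd)
  then show ?thesis
    using cd by (intro exI[of _ "4 * (c + 5 * d)"]) (simp add: numer_def numeral_fps_const)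
qed

text \<open>The square-summable series \<open>(1 - z) h\<close> and \<open>numer h\<close> determine \<open>h\<close>, since \<open>numer\<close> does not
  vanish at $z = 1$.\<close>

lemma sq_summable_inverse_denom:
  assumes p: "sq_summable (numer (Suc n) * h)" and h: "sq_summable ((1 - fps_X) * h)"
  shows "sq_summable h"
proof -
  obtain c k where c: "c > 0" and k: "\<And>a. sq_summable a \<Longrightarrow> sq_summable (k * a)"
    and eq: "numer (Suc n) = fps_const c + (1 - fps_X) * k"
    using near_one_numer unfolding near_one_def by blast
  have "h = fps_const (1 / c) * (fps_const c * h)"
    using c by (simp flip: mult.assoc)
  also have "fps_const c * h = numer (Suc n) * h + fps_const (-1) * (k * ((1 - fps_X) * h))"
    by (simp add: eq algebra_simps flip: fps_const_neg)
  finally have "h = fps_const (1 / c) * \<dots>" .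
  moreover have "sq_summable \<dots>"
    by (intro sq_summable_const_mult sq_summable_add p k h)
  ultimately show ?thesis by metis
qed


section \<open>Generating functions of the walk\<close>

definition surviving :: "nat \<Rightarrow> nat \<Rightarrow> state" where
  "surviving N t = (no_step 1 N ^^ t) (initial_state 0 0 1)"

text \<open>The state just before the boundary measurements, so that the amplitudes being absorbed
  are still visible; time 0 holds the initial state.\<close>

definition arriving :: "nat \<Rightarrow> nat \<Rightarrow> state" where
  "arriving N t = (case t of 0 \<Rightarrow> initial_state 0 0 1 | Suc t \<Rightarrow> evolution (surviving N t))"

lemma evolution_component:
  "evolution \<psi> m $ L = (2 * \<psi> (m + 1) $ S + 2 * \<psi> (m + 1) $ R - \<psi> (m + 1) $ L) / 3"
  "evolution \<psi> m $ S = (2 * \<psi> m $ L + 2 * \<psi> m $ R - \<psi> m $ S) / 3"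
  "evolution \<psi> m $ R = (2 * \<psi> (m - 1) $ L + 2 * \<psi> (m - 1) $ S - \<psi> (m - 1) $ R) / 3"
  by (simp_all add: evolution_def shift_def coin_flip_def matrix_vector_mult_def sum_coin
      grover_def field_simps)

lemma surviving_Suc:
  "surviving N (Suc t) m = (if m = -1 \<or> m = int N then 0 else evolution (surviving N t) m)"
  by (simp add: surviving_def no_step_def proj_no_def proj_yes_def)

lemma initial_component:
  "initial_state 0 0 1 m $ c = (if m = 0 \<and> c = R then 1 else 0)"
  by (auto simp: initial_state_def ket_def axis_def)

text \<open>One step moves by at most one site, so the outside can be entered only through a
  boundary site, and those are emptied at every step.\<close>

lemma surviving_outside:
  assumes "1 \<le> N" "m < 0 \<or> int N \<le> m"
  shows "surviving N t m = 0"
  using assms(2)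
proof (induction t arbitrary: m)
  case 0
  then show ?case
    using assms(1) by (auto simp: surviving_def vec_eq_coin initial_component)
next
  case (Suc t)
  show ?case
  proof (cases "m = -1 \<or> m = int N")
    case True
    then show ?thesis by (simp add: surviving_Suc)
  next
    case False
    then have "surviving N t m = 0" "surviving N t (m + 1) = 0" "surviving N t (m - 1) = 0"
      using Suc by auto
    then show ?thesis
      by (simp add: surviving_Suc vec_eq_coin evolution_component)
  qed
qed

lemma surviving_inside:
  assumes "0 \<le> m" "m < int N"
  shows "surviving N t m = arriving N t m"
  using assms by (cases t) (simp_all add: surviving_Suc arriving_def, simp add: surviving_def)

lemma Im_surviving: "Im (surviving N t m $ c) = 0"
proof (induction t arbitrary: m c)
  case 0
  then show ?case by (simp add: surviving_def initial_component)
next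
  case (Suc t)
  then show ?case by (cases c) (simp_all add: surviving_Suc evolution_component)
qed

lemma Im_arriving: "Im (arriving N t m $ c) = 0"
proof (cases t)
  case 0
  then show ?thesis by (simp add: arriving_def initial_component)
next
  case (Suc t)
  then show ?thesis by (cases c) (simp_all add: arriving_def evolution_component Im_surviving)
qed

text \<open>Generating function in time. Taking real parts loses nothing, by
  \<open>Im_arriving\<close>.\<close>

definition amp :: "nat \<Rightarrow> coin \<Rightarrow> int \<Rightarrow> real fps" where
  "amp N c m = Abs_fps (\<lambda>t. Re (arriving N t m $ c))"

text \<open>The system is homogeneous: the initial amplitude sits in the R component at site 0,
  whereas the third equation concerns sites m + 1 > 0. The source enters through
  \<open>amp_R_0\<close> instead.\<close>

lemma amp_equations:
  assumes "1 \<le> N" "0 \<le> m" "m < int N"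
  shows "3 * amp N L (m - 1) = fps_X * (2 * amp N S m + 2 * amp N R m - amp N L m)"
    and "3 * amp N S m = fps_X * (2 * amp N L m + 2 * amp N R m - amp N S m)"
    and "3 * amp N R (m + 1) = fps_X * (2 * amp N L m + 2 * amp N S m - amp N R m)"
proof -
  have Suc: "arriving N (Suc t) = evolution (surviving N t)" for t
    by (simp add: arriving_def)
  have zero: "Re (arriving N 0 k $ c) = (if k = 0 \<and> c = R then 1 else 0)" for k c
    by (simp add: arriving_def initial_component)
  have "fps_nth (3 * amp N L (m - 1)) t = fps_nth (fps_X * (2 * amp N S m + 2 * amp N R m - amp N L m)) t"
    "fps_nth (3 * amp N S m) t = fps_nth (fps_X * (2 * amp N L m + 2 * amp N R m - amp N S m)) t"
    "fps_nth (3 * amp N R (m + 1)) t = fps_nth (fps_X * (2 * amp N L m + 2 * amp N S m - amp N R m)) t" for t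
    using assms
    by (cases t; simp add: numeral_fps_const amp_def zero Suc evolution_component surviving_inside)+
  then show "3 * amp N L (m - 1) = fps_X * (2 * amp N S m + 2 * amp N R m - amp N L m)"
    "3 * amp N S m = fps_X * (2 * amp N L m + 2 * amp N R m - amp N S m)"
    "3 * amp N R (m + 1) = fps_X * (2 * amp N L m + 2 * amp N S m - amp N R m)"
    by (simp_all add: fps_eq_iff)
qed

text \<open>The R component at 0 is fed from the empty site -1, so only the initial state
  contributes. Likewise the L component at N - 1 is fed from the empty site N.\<close>

lemma amp_R_0:
  assumes "1 \<le> N"
  shows "amp N R 0 = 1"
proof (rule fps_ext)
  show "fps_nth (amp N R 0) t = fps_nth 1 t" for t
    using surviving_outside[OF assms]
    by (cases t) (simp_all add: amp_def arriving_def initial_component evolution_component)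
qed

lemma amp_L_last:
  assumes "1 \<le> N"
  shows "amp N L (int N - 1) = 0"
proof (rule fps_ext)
  show "fps_nth (amp N L (int N - 1)) t = fps_nth 0 t" for t
    using surviving_outside[OF assms]
    by (cases t) (simp_all add: amp_def arriving_def initial_component evolution_component)
qed

text \<open>Eliminating the S component through (3 + z) s = 2z (a + b) expresses the pair (R at m, L
  at m - 1) by the pair one site to the right.\<close>

lemma transfer_step:
  assumes "1 \<le> N" "0 \<le> m" "m < int N"
  defines "D \<equiv> fps_X * (1 - fps_X)"
  shows "D * amp N R m = 2 * fps_X * (1 + fps_X) * amp N L m - (3 + fps_X) * amp N R (m + 1)"
    and "D * amp N L (m - 1) = fps_X\<^sup>2 * (3 * fps_X + 1) * amp N L m
           - 2 * fps_X * (1 + fps_X) * amp N R (m + 1)"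
proof -
  have gen: "z * (1 - z) * a = 2 * z * (1 + z) * b - (3 + z) * a'"
    "z * (1 - z) * b' = z\<^sup>2 * (3 * z + 1) * b - 2 * z * (1 + z) * a'"
    if eqs: "3 * b' = z * (2 * s + 2 * a - b)" "3 * s = z * (2 * b + 2 * a - s)"
      "3 * a' = z * (2 * b + 2 * s - a)" and nz: "3 + z \<noteq> 0" for z a b s a' b' :: "real fps"
  proof -
    have s: "(3 + z) * s = 2 * z * (a + b)" using eqs(2) by algebra
    have "3 * (z * (1 - z) * a) = 3 * (2 * z * (1 + z) * b - (3 + z) * a')"
      using eqs s by algebra
    then show 1: "z * (1 - z) * a = 2 * z * (1 + z) * b - (3 + z) * a'"
      by (metis mult_cancel_left zero_neq_numeral)
    have "(3 * (3 + z)) * (z * (1 - z) * b') = (3 * (3 + z)) * (z\<^sup>2 * (3 * z + 1) * b - 2 * z * (1 + z) * a')"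
      using eqs s 1 by algebra
    then show "z * (1 - z) * b' = z\<^sup>2 * (3 * z + 1) * b - 2 * z * (1 + z) * a'"
      using nz by (metis mult_cancel_left no_zero_divisors zero_neq_numeral)
  qed
  have "fps_nth (3 + fps_X :: real fps) 0 \<noteq> fps_nth 0 0" by simp
  then have "(3 + fps_X :: real fps) \<noteq> 0" by metis
  from gen[OF amp_equations[OF assms(1-3)] this]
  show "D * amp N R m = 2 * fps_X * (1 + fps_X) * amp N L m - (3 + fps_X) * amp N R (m + 1)"
    "D * amp N L (m - 1) = fps_X\<^sup>2 * (3 * fps_X + 1) * amp N L m
           - 2 * fps_X * (1 + fps_X) * amp N R (m + 1)"
    unfolding D_def by blast+
qed

lemma one_minus_X_nonzero: "1 - fps_X \<noteq> (0 :: real fps)"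
proof -
  have "fps_nth (1 - fps_X :: real fps) 0 \<noteq> fps_nth 0 0" by simp
  then show ?thesis by metis
qed

text \<open>The iteration runs leftwards from the right boundary, where the L entry vanishes and the
  pair is a multiple of (1, 0).\<close>

lemma transfer_iterate:
  assumes "1 \<le> N" "j \<le> N"
  shows "(- fps_X) ^ j * (1 - fps_X) * amp N R (int N - int j) = denom j * amp N R (int N)
    \<and> (- fps_X) ^ j * (1 - fps_X) * amp N L (int N - int j - 1) = numer j * amp N R (int N)"
  using assms(2)
proof (induction j)
  case 0
  then show ?case using amp_L_last[OF assms(1)] by (simp add: denom_def numer_def)
next
  case (Suc j)
  define m where "m = int N - int (Suc j)"
  define z where "z = (fps_X :: real fps)"
  have m: "0 \<le> m" "m < int N" "int N - int j = m + 1" "int N - int j - 1 = m"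
    using Suc.prems by (simp_all add: m_def)
  note IH = Suc.IH[OF Suc_leD[OF Suc.prems], unfolded m(4), unfolded m(3), folded z_def]
  note step = transfer_step[OF assms(1) m(1,2), folded z_def]
  note pq = denom_Suc[of j, folded z_def] numer_Suc[of j, folded z_def]
  let ?a = "amp N R m" and ?b = "amp N L m" and ?a' = "amp N R (m + 1)"
    and ?b' = "amp N L (m - 1)" and ?t = "amp N R (int N)"
  \<comment> \<open>The recursions for \<open>denom\<close> and \<open>numer\<close> hold only after
    multiplication by 1 - z; this extra factor is cancelled at the end.\<close>
  have gen: "(1 - z) * (- (z * w) * (1 - z) * a) = (1 - z) * (q' * t)"
      "(1 - z) * (- (z * w) * (1 - z) * b') = (1 - z) * (p' * t)"
    if "z * (1 - z) * a = 2 * z * (1 + z) * b - (3 + z) * a'"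
      "z * (1 - z) * b' = z\<^sup>2 * (3 * z + 1) * b - 2 * z * (1 + z) * a'"
      "w * (1 - z) * a' = q * t" "w * (1 - z) * b = p * t"
      "(1 - z) * q' = (3 + z) * q - 2 * z * (1 + z) * p"
      "(1 - z) * p' = 2 * z * (1 + z) * q - z\<^sup>2 * (3 * z + 1) * p"
    for w a b a' b' q p q' p' t
    using that by algebra+
  have "(- z) ^ Suc j = - (z * (- z) ^ j)" by simp
  moreover note gen[OF step conjunct1[OF IH] conjunct2[OF IH] pq]
  ultimately show ?case
    using one_minus_X_nonzero unfolding m_def[symmetric] z_def by (metis mult_cancel_left)
qed

section \<open>Absorption\<close>

lemma walk_norm_proj_yes: "(walk_norm (proj_yes n \<psi>))\<^sup>2 = (norm (\<psi> n))\<^sup>2"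
proof -
  have "(\<Sum>\<^sub>\<infinity>m. (norm (proj_yes n \<psi> m))\<^sup>2) = (\<Sum>\<^sub>\<infinity>m\<in>{n}. (norm (\<psi> n))\<^sup>2)"
    by (rule infsum_cong_neutral) (auto simp: proj_yes_def)
  then show ?thesis by (simp add: walk_norm_def)
qed

lemma left_exit:
  assumes "1 \<le> N"
  shows "(walk_norm (proj_yes (- 1) (evolution (surviving N t))))\<^sup>2 = (fps_nth (amp N L (- 1)) (Suc t))\<^sup>2"
proof -
  have "evolution (surviving N t) (-1) $ c = 0" if "c \<noteq> L" for c
    using that surviving_outside[OF assms] by (cases c) (simp_all add: evolution_component)
  moreover have "(cmod (arriving N (Suc t) (-1) $ L))\<^sup>2 = (Re (arriving N (Suc t) (-1) $ L))\<^sup>2"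
    by (simp add: cmod_power2 Im_arriving)
  ultimately show ?thesis
    by (simp add: walk_norm_proj_yes norm_coin amp_def arriving_def)
qed

lemma bij_betw_pred: "bij_betw (\<lambda>t::nat. t - 1) {1..} UNIV"
  by (rule bij_betw_byWitness[where f' = Suc]) auto

lemma amp_L_exit_nth_0: "fps_nth (amp N L m) 0 = 0"
  by (simp add: amp_def arriving_def initial_component)

lemma left_exit_sum:
  assumes "1 \<le> N"
  shows "sq_summable (amp N L (- 1))"
    and "left_absorption 1 N 0 0 1 = pairing (amp N L (- 1)) (amp N L (- 1))"
proof -
  let ?f = "\<lambda>t. (fps_nth (amp N L (- 1)) (Suc t))\<^sup>2"
  have eq: "(walk_norm (proj_yes (- int 1) (evolution ((no_step 1 N ^^ t) (initial_state 0 0 1)))))\<^sup>2 = ?f t" for t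
    using left_exit[OF assms, of t] by (simp add: surviving_def)
  have "(\<lambda>t. ?f (t - 1)) summable_on {1..}"
    using left_absorption_summable[of 1 N 0 0 1] unfolding eq .
  then have "?f summable_on UNIV"
    using summable_on_reindex_bij_betw[OF bij_betw_pred, of ?f] by simp
  then have f: "(?f has_sum infsum ?f UNIV) UNIV" by simp
  then have sums: "?f sums infsum ?f UNIV" by (rule has_sum_imp_sums)
  then have "summable ?f" by (rule sums_summable)
  then show sq: "sq_summable (amp N L (- 1))"
    unfolding sq_summable_def by (subst summable_Suc_iff[symmetric])
  have "left_absorption 1 N 0 0 1 = infsum (\<lambda>t. ?f (t - 1)) {1..}"
    unfolding left_absorption_def eq ..
  also have "\<dots> = infsum ?f UNIV"
    using infsum_reindex_bij_betw[OF bij_betw_pred, of ?f] by simp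
  also have "\<dots> = suminf ?f" using sums by (simp add: sums_iff)
  \<comment> \<open>Time 0 may be added because its coefficient is zero.\<close>
  also have "\<dots> = (\<Sum>t. (fps_nth (amp N L (- 1)) t)\<^sup>2)"
    using suminf_split_head[OF sq[unfolded sq_summable_def]] by (simp add: amp_L_exit_nth_0)
  finally show "left_absorption 1 N 0 0 1 = pairing (amp N L (- 1)) (amp N L (- 1))"
    by (simp add: pairing_def power2_eq_square)
qed

text \<open>The norm lost in each step bounds the probability of leaving on the right, and these
  losses telescope. Up to sign and a power of z this amplitude is (1 - z)/q, which yields the second
  hypothesis of \<open>sq_summable_inverse_denom\<close>.\<close>

lemma right_exit_sum:
  assumes "1 \<le> N"
  shows "sq_summable (amp N R (int N))"
proof -
  define a where "a t = (fps_nth (amp N R (int N)) (Suc t))\<^sup>2" for t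
  have space: "surviving N t \<in> walk_space" for t
    by (induction t)
       (simp_all add: surviving_def no_step_def initial_state_space proj_pythagoras evolution_isometry)
  have step: "a t + (walk_norm (surviving N (Suc t)))\<^sup>2 \<le> (walk_norm (surviving N t))\<^sup>2" for t
  proof -
    let ?e = "evolution (surviving N t)"
    let ?l = "proj_no (-1) ?e"
    have e: "?e \<in> walk_space" by (rule evolution_isometry[OF space])
    have suc: "surviving N (Suc t) = proj_no (int N) ?l"
      by (simp add: surviving_def no_step_def)
    have "a t \<le> (norm (?l (int N)))\<^sup>2"
      unfolding a_def norm_coin
      by (simp add: amp_def arriving_def proj_no_def proj_yes_def cmod_power2)
    then have "a t \<le> (walk_norm (proj_yes (int N) ?l))\<^sup>2"
      by (simp add: walk_norm_proj_yes)
    then show ?thesis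
      using proj_pythagoras(3)[OF e, of "-1", unfolded evolution_isometry(2)[OF space]]
        proj_pythagoras(3)[OF proj_pythagoras(2)[OF e, of "-1"], of "int N"]
        zero_le_power2[of "walk_norm (proj_yes (-1) ?e)"]
      unfolding suc by linarith
  qed
  have bound: "sum a {..<n} + (walk_norm (surviving N n))\<^sup>2 \<le> (walk_norm (surviving N 0))\<^sup>2" for n
  proof (induction n)
    case (Suc n)
    then show ?case using step[of n] by simp
  qed simp
  have "summable a"
  proof (rule summableI_nonneg_bounded)
    show "0 \<le> a n" for n by (simp add: a_def)
    show "sum a {..<n} \<le> (walk_norm (surviving N 0))\<^sup>2" for n
      using bound[of n] zero_le_power2[of "walk_norm (surviving N n)"] by linarith
  qed
  then show ?thesis
    unfolding sq_summable_def a_def by (subst summable_Suc_iff[symmetric])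
qed

lemma left_absorption_eq_node_ratio: "left_absorption 1 (Suc n) 0 0 1 = node_ratio (Suc n)"
proof -
  let ?N = "Suc n"
  define q where "q = denom ?N"
  define p where "p = numer ?N"
  define h where "h = inverse q"
  define \<tau> where "\<tau> = amp ?N R (int ?N)"
  define f where "f = amp ?N L (- 1)"
  define w where "w = (- fps_X :: real fps) ^ ?N"
  have "fps_nth q 0 \<noteq> 0"
    using cheb_nth_0[of n] by (simp add: q_def denom_nth_0)
  then have qh: "q * h = 1"
    unfolding h_def by (metis inverse_mult_eq_1 mult.commute)
  \<comment> \<open>The full sweep j = N reaches site 0, where the R series is 1, and the exit at
    -1. Dividing the two equations gives f = p/q.\<close>
  have tr: "w * (1 - fps_X) = q * \<tau>" "w * (1 - fps_X) * f = p * \<tau>"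
    using conjunct1[OF transfer_iterate[of ?N ?N]] conjunct2[OF transfer_iterate[of ?N ?N]] amp_R_0[of ?N]
    unfolding q_def p_def \<tau>_def f_def w_def by simp_all
  have "w \<noteq> 0" by (simp add: w_def)
  have \<tau>: "\<tau> = w * ((1 - fps_X) * h)"
    using tr(1) qh by (metis mult.assoc mult.commute mult.left_neutral)
  have "w * (1 - fps_X) * f = w * (1 - fps_X) * (p * h)"
    unfolding tr(2) \<tau> by (simp add: ac_simps)
  then have f: "f = p * h"
    using \<open>w \<noteq> 0\<close> one_minus_X_nonzero by (metis mult_cancel_left no_zero_divisors)
  \<comment> \<open>The sign is split off so that the remaining power of z can be stripped without
    affecting square-summability.\<close>
  have "fps_const ((-1) ^ ?N) * \<tau> = fps_X ^ ?N * ((1 - fps_X) * h)"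
    unfolding \<tau> w_def power_minus[of fps_X] by (simp flip: fps_const_neg fps_const_power)
  moreover have "sq_summable (fps_const ((-1) ^ ?N) * \<tau>)"
    using right_exit_sum[of ?N] by (intro sq_summable_const_mult) (simp add: \<tau>_def)
  ultimately have "sq_summable ((1 - fps_X) * h)"
    by (metis sq_summable_X_power_mult)
  moreover have "sq_summable (p * h)"
    using left_exit_sum(1)[of ?N] f by (simp add: f_def)
  ultimately have "sq_summable h"
    unfolding p_def by (metis sq_summable_inverse_denom)
  from pairing_numer_denom[OF this qh[unfolded q_def]]
  show ?thesis
    using left_exit_sum(2)[of ?N] f unfolding f_def p_def by simp
qed

text \<open>The convention at N = 0 agrees with the closed form because U_{-1} = 0.\<close>

lemma P_left_eq_node_ratio: "P_left N = node_ratio N"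
  by (cases N) (simp_all add: P_left_def left_absorption_eq_node_ratio node_ratio_def del: One_nat_def)

theorem theorem4:
  fixes N :: nat
  shows "P_left (N + 1) = (2 + 3 * P_left N) / (3 + 4 * P_left N)"
  by (simp add: P_left_eq_node_ratio node_ratio_Suc)

end
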